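(* Fix real numbers $0<p<1$ and $0<\varepsilon<1$, integers $m\ge d\ge 1$, and vectors $\boldsymbol v_1,\dots,\boldsymbol v_m\in\mathbb{R}^d$ spanning $\mathbb{R}^d$. Then there is a constant $c>0$, depending only on $p$, $\varepsilon$, $d$ and $\boldsymbol v_1,\dots,\boldsymbol v_m$, such that the following holds. Let $n$ be any positive integer and $\boldsymbol f:\{0,1\}^n\to\mathbb{R}^d$ any function. Let $\boldsymbol\xi=(\xi_1,\dots,\xi_n)$ have independent $\mathrm{Ber}(p)$ coordinates, and for $i=1,\dots,n$ define the random vectors \[ \Delta_i\boldsymbol f(\boldsymbol\xi)=\boldsymbol f(\xi_1,\dots,\xi_{i-1},1,\xi_{i+1},\dots,\xi_n)-\boldsymbol f(\xi_1,\dots,\xi_{i-1},0,\xi_{i+1},\dots,\xi_n). \] Suppose that for some positive real numbers $r,s$ with $r\sqrt{n\log n}\ge s$ there are pairwise disjoint subsets $I_1,\dots,I_m\subseteq\{1,\dots,n\}$, each of size at least $\varepsilon n$, such that for every $j\in\{1,\dots,m\}$ and every $i\in I_j$ we have \[ \Pr\big(\|\Delta_i\boldsymbol f(\boldsymbol\xi)-s\boldsymbol v_j\|_\infty\ge r\big)\le n^{-6d^2}. \] Then for every $\boldsymbol x\in\mathbb{R}^d$, \[ \Pr\big(\|\boldsymbol f(\boldsymbol\xi)-\boldsymbol x\|_\infty<r\sqrt{n\log n}\big)\le c\left(\frac{r\sqrt{\log n}}{s}\right)^d. \]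
   Context: $\mathrm{Ber}(p)$ is the distribution of a random variable equal to $1$ with probability $p$ and $0$ with probability $1-p$. Logarithms are natural. *)

theory Defs
  imports "HOL-Probability.Probability" "HOL-Probability.Product_PMF"
begin

text \<open>A point of the cube of dimension \<open>n\<close> is a function \<open>nat \<Rightarrow> bool\<close> that is \<open>False\<close>
  outside \<open>{1..n}\<close>, with \<open>True\<close> and \<open>False\<close> standing for \<open>1\<close> and \<open>0\<close>.  A function on
  the cube is represented by a function on all of \<open>nat \<Rightarrow> bool\<close>, of which only the values on
  such points matter.\<close>

definition ber_cube :: "real \<Rightarrow> nat \<Rightarrow> (nat \<Rightarrow> bool) pmf" where
  "ber_cube p n = Pi_pmf {1..n} False (\<lambda>_. bernoulli_pmf p)"

definition discrete_deriv :: "nat \<Rightarrow> ((nat \<Rightarrow> bool) \<Rightarrow> 'b::group_add) \<Rightarrow> (nat \<Rightarrow> bool) \<Rightarrow> 'b" where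
  "discrete_deriv i f \<xi> = f (\<xi>(i := True)) - f (\<xi>(i := False))"

end

theory Submission
  imports Defs
begin

text \<open>
  Select \<open>d\<close> blocks whose vectors form a basis.  Sample \<open>\<xi>\<close> by applying a uniformly random
  block-preserving permutation to the configuration whose \<open>k\<close>-th block starts with \<open>a k\<close> ones,
  where the \<open>a k\<close> are independent binomials.  For a fixed permutation this embeds a \<open>d\<close>-dimensional
  grid into the cube, and neighbouring grid points differ in one coordinate.  Restrict \<open>a\<close> to the box
  where each binomial weight is at least \<open>n ^ - (d + 1)\<close>: leaving the box is unlikely, and since all
  weights inside are polynomially large, with high probability no derivative along the grid is bad.
  Then \<open>f\<close> is a quasi-isometry on the box as soon as \<open>r\<close> is small compared with \<open>s\<close>, so that a
  ball of radius \<open>r * sqrt (n * ln n)\<close> contains \<open>O((r * sqrt (n * ln n) / s) ^ d)\<close> grid points,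
  each of weight \<open>O(n powr (- d / 2))\<close>.  If \<open>r\<close> is not small, the bound is trivial.
\<close>

subsection \<open>Binomial weights\<close>

text \<open>The ratio of consecutive weights, cross-multiplied so that it survives for
  \<open>a \<ge> k\<close>, where the right side vanishes through the factor \<open>k - a\<close> or
  through the weight itself.\<close>

lemma binomial_pmf_recurrence:
  assumes "0 \<le> p" "p \<le> 1"
  shows "(real a + 1) * (1 - p) * pmf (binomial_pmf k p) (Suc a)
           = (real k - real a) * p * pmf (binomial_pmf k p) a"
proof (cases "a < k")
  case True
  have "Suc a * (k choose Suc a) = (k - a) * (k choose a)"
    by (simp only: binomial_absorption binomial_absorb_comp)
  hence "real (Suc a * (k choose Suc a)) = real ((k - a) * (k choose a))"
    by (rule arg_cong)
  hence *: "(real a + 1) * real (k choose Suc a) = (real k - real a) * real (k choose a)"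
    using True by (simp add: of_nat_diff algebra_simps)
  obtain b where b: "k = Suc (a + b)"
    using less_imp_Suc_add[OF True] by auto
  have "(real a + 1) * (1 - p) * pmf (binomial_pmf k p) (Suc a)
          = ((real a + 1) * real (k choose Suc a)) * (p * p ^ a * ((1 - p) * (1 - p) ^ b))"
    using assms by (simp add: b mult_ac)
  also have "\<dots> = (real k - real a) * p * pmf (binomial_pmf k p) a"
    unfolding * using assms by (simp add: b mult_ac Suc_diff_le)
  finally show ?thesis .
next
  case False
  hence "pmf (binomial_pmf k p) (Suc a) = 0" "a = k \<or> pmf (binomial_pmf k p) a = 0"
    using assms by (auto simp: binomial_eq_0)
  thus ?thesis by auto
qed

text \<open>Unimodality: the weights increase up to about \<open>(k + 1) * p\<close> and decrease
  afterwards, so superlevel sets are intervals. This keeps monotone paths between two points of the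
  box inside the box.\<close>

lemma binomial_pmf_interval:
  assumes p: "0 < p" "p < 1"
    and "a \<le> b" "b \<le> c"
    and "\<theta> \<le> pmf (binomial_pmf k p) a" "\<theta> \<le> pmf (binomial_pmf k p) c"
  shows "\<theta> \<le> pmf (binomial_pmf k p) b"
proof -
  define g where "g = pmf (binomial_pmf k p)"
  have rec: "(real i + 1) * (1 - p) * g (Suc i) = (real k - real i) * p * g i" for i
    unfolding g_def using p by (intro binomial_pmf_recurrence) auto
  have g0: "g i \<ge> 0" for i
    unfolding g_def by simp
  have up: "g i \<le> g (Suc i)" if "real i + 1 \<le> (real k + 1) * p" for i
  proof -
    have "(real i + 1) * (1 - p) * g i \<le> (real k - real i) * p * g i"
      using that by (intro mult_right_mono g0) (simp add: algebra_simps)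
    also have "\<dots> = (real i + 1) * (1 - p) * g (Suc i)"
      by (simp add: rec)
    finally show ?thesis
      using p by (simp add: mult_le_cancel_left)
  qed
  have down: "g (Suc i) \<le> g i" if "real i + 1 \<ge> (real k + 1) * p" for i
  proof -
    have "(real i + 1) * (1 - p) * g (Suc i) = (real k - real i) * p * g i"
      by (simp add: rec)
    also have "\<dots> \<le> (real i + 1) * (1 - p) * g i"
      using that by (intro mult_right_mono g0) (simp add: algebra_simps)
    finally show ?thesis
      using p by (simp add: mult_le_cancel_left)
  qed
  show ?thesis
  \<comment> \<open>On the left of the peak \<open>b\<close> is compared with \<open>a\<close>, on
    the right with \<open>c\<close>.\<close>
  proof (cases "real b \<le> (real k + 1) * p")
    case True
    have "g a \<le> g b"
      using \<open>a \<le> b\<close> True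
    proof (induction rule: dec_induct)
      case (step i)
      thus ?case using up[of i] by simp
    qed simp
    thus ?thesis using assms g_def by simp
  next
    case False
    have "g c \<le> g b"
      using \<open>b \<le> c\<close>
    proof (induction rule: dec_induct)
      case (step i)
      thus ?case using down[of i] False by simp
    qed simp
    thus ?thesis using assms g_def by simp
  qed
qed

text \<open>With V the variance, the step from \<open>a + i\<close> to \<open>a + i + 1\<close>
  multiplies the weight by at least 1 - (i + 1) / V, because a mode lies within 1 of the mean. The
  product of these factors over i < t is at least 1 - t^2 / V. The weight is thus flat on the scale
  of the standard deviation.\<close>

lemma binomial_pmf_near_max:
  assumes p: "0 < p" "p < 1" and k: "k > 0"
    and max: "\<And>b. pmf (binomial_pmf k p) b \<le> pmf (binomial_pmf k p) a"
  shows "pmf (binomial_pmf k p) a * (1 - real t ^ 2 / (real k * p * (1 - p)))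
           \<le> pmf (binomial_pmf k p) (a + t)"
proof -
  define g where "g = pmf (binomial_pmf k p)"
  define V where "V = real k * p * (1 - p)"
  have V: "V > 0" using p k by (simp add: V_def)
  have rec: "(real i + 1) * (1 - p) * g (Suc i) = (real k - real i) * p * g i" for i
    unfolding g_def using p by (intro binomial_pmf_recurrence) auto
  have g0: "g i \<ge> 0" for i
    unfolding g_def by simp
  have gm: "g i \<le> g a" for i
    unfolding g_def by (rule max)
  have ga: "g a > 0"
  proof (rule ccontr)
    assume "\<not> g a > 0"
    hence "g 0 \<le> 0" using gm[of 0] by linarith
    moreover have "0 < (1 - p) ^ k" using p by simp
    ultimately show False using p by (simp add: g_def)
  qed
  \<comment> \<open>The two bounds locate the mode: they come from comparing its weight with that of
    its right and of its left neighbour.\<close>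
  have lo: "real k * p \<le> real a + 1"
  proof -
    have "(real k - real a) * p * g a = (real a + 1) * (1 - p) * g (Suc a)"
      by (simp add: rec)
    also have "\<dots> \<le> (real a + 1) * (1 - p) * g a"
      using p by (intro mult_left_mono gm) auto
    finally have "(real k - real a) * p \<le> (real a + 1) * (1 - p)"
      using ga by (simp add: mult_le_cancel_right)
    thus ?thesis using p by (simp add: algebra_simps)
  qed
  have hi: "real a \<le> (real k + 1) * p"
  proof (cases a)
    case (Suc b)
    have "(real b + 1) * (1 - p) * g a = (real k - real b) * p * g b"
      using rec[of b] Suc by simp
    also have "\<dots> \<le> (real k - real b) * p * g a"
    proof -
      have "a \<le> k"
      proof (rule ccontr)
        assume "\<not> a \<le> k"
        hence "g a = 0" using p by (simp add: g_def)
        thus False using ga by simp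
      qed
      thus ?thesis using p Suc by (intro mult_left_mono gm) auto
    qed
    finally have "(real b + 1) * (1 - p) \<le> (real k - real b) * p"
      using ga by (simp add: mult_le_cancel_right)
    thus ?thesis using Suc by (simp add: algebra_simps)
  qed (use p in simp)
  have ratio: "g (a + i) * (1 - (real i + 1) / V) \<le> g (Suc (a + i))" for i
  proof -
    define D where "D = (real (a + i) + 1) * (1 - p)"
    have D: "V \<le> D"
      unfolding V_def D_def using p lo by (intro mult_right_mono) auto
    have "D * (1 - (real i + 1) / V) \<le> D - (real i + 1)"
    proof -
      have "1 * (real i + 1) \<le> (D / V) * (real i + 1)"
        using D V by (intro mult_right_mono) auto
      thus ?thesis by (simp add: right_diff_distrib)
    qed
    also have "\<dots> \<le> (real k - real (a + i)) * p"
      using hi unfolding D_def by (simp add: algebra_simps)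
    finally have "D * (1 - (real i + 1) / V) * g (a + i) \<le> (real k - real (a + i)) * p * g (a + i)"
      by (intro mult_right_mono g0)
    also have "\<dots> = D * g (Suc (a + i))"
      unfolding D_def by (simp only: rec)
    finally have "D * (g (a + i) * (1 - (real i + 1) / V)) \<le> D * g (Suc (a + i))"
      by (simp add: mult_ac)
    thus ?thesis using D V by (simp add: mult_le_cancel_left)
  qed
  have "g a * (1 - real t ^ 2 / V) \<le> g (a + t)"
  proof (induction t)
    case (Suc t)
    show ?case
    \<comment> \<open>The induction hypothesis may be multiplied by the next factor only if that
      factor is nonnegative; otherwise the claimed lower bound is at most 0 anyway.\<close>
    proof (cases "(real t + 1) / V \<le> 1")
      case True
      have sq: "real t ^ 2 + (real t + 1) \<le> real (Suc t) ^ 2"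
        by (simp add: power2_eq_square algebra_simps)
      have "real t ^ 2 / V + (real t + 1) / V \<le> real (Suc t) ^ 2 / V"
        using V sq by (simp only: add_divide_distrib[symmetric]) (rule divide_right_mono, auto)
      moreover have "0 \<le> (real t ^ 2 / V) * ((real t + 1) / V)"
        using V by simp
      moreover have "(1 - x) * (1 - y) = 1 - (x + y) + x * y" for x y :: real
        by (simp add: algebra_simps)
      ultimately have "1 - real (Suc t) ^ 2 / V \<le> (1 - real t ^ 2 / V) * (1 - (real t + 1) / V)"
        by (metis add_increasing2 diff_left_mono)
      hence "g a * (1 - real (Suc t) ^ 2 / V) \<le> g a * ((1 - real t ^ 2 / V) * (1 - (real t + 1) / V))"
        using g0 by (intro mult_left_mono) auto
      also have "\<dots> = (g a * (1 - real t ^ 2 / V)) * (1 - (real t + 1) / V)"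
        by simp
      also have "\<dots> \<le> g (a + t) * (1 - (real t + 1) / V)"
        using Suc.IH True by (intro mult_right_mono) auto
      also have "\<dots> \<le> g (a + Suc t)"
        using ratio[of t] by simp
      finally show ?thesis .
    next
      case False
      hence "V \<le> real (Suc t)" using V by (simp add: field_simps)
      also have "\<dots> \<le> real (Suc t) ^ 2" by (simp add: power2_eq_square)
      finally have "g a * (1 - real (Suc t) ^ 2 / V) \<le> 0"
        using V g0 by (intro mult_nonneg_nonpos) (auto simp: field_simps)
      thus ?thesis using g0[of "a + Suc t"] by linarith
    qed
  qed simp
  thus ?thesis by (simp add: g_def V_def)
qed

text \<open>About \<open>sqrt V\<close> points to the right of a mode carry at least half of the
  maximal weight each, and their total is at most 1.\<close>

lemma pmf_binomial_le_inverse_sqrt: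
  assumes p: "0 < p" "p < 1" and k: "k > 0"
  shows "pmf (binomial_pmf k p) b \<le> 4 / sqrt (real k * p * (1 - p))"
proof -
  define g where "g = pmf (binomial_pmf k p)"
  define V where "V = real k * p * (1 - p)"
  have V: "V > 0" using p k by (simp add: V_def)
  have "Max (g ` {..k}) \<in> g ` {..k}" by (intro Max_in) auto
  then obtain a where a: "g a = Max (g ` {..k})" by (metis imageE)
  have gm: "g i \<le> g a" for i
  proof (cases "i \<le> k")
    case True
    thus ?thesis using a by simp
  next
    case False
    hence "g i = 0" using p by (simp add: g_def)
    thus ?thesis by (simp add: g_def)
  qed
  \<comment> \<open>The largest distance for which the loss \<open>t ^ 2 / V\<close> stays below
    1/2; there are \<open>Suc T \<ge> sqrt (V / 2)\<close> admissible shifts.\<close>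
  define T where "T = nat \<lfloor>sqrt (V / 2)\<rfloor>"
  have "0 \<le> sqrt (V / 2)" using V by simp
  hence T1: "real T \<le> sqrt (V / 2)" and T2: "sqrt (V / 2) \<le> real (Suc T)"
    unfolding T_def by linarith+
  have half: "g a / 2 \<le> g (a + t)" if "t \<le> T" for t
  proof -
    have "real t \<le> sqrt (V / 2)" using T1 that by linarith
    hence "real t ^ 2 \<le> sqrt (V / 2) ^ 2" by (intro power_mono) auto
    hence "real t ^ 2 \<le> V / 2" using V by simp
    hence "1 / 2 \<le> 1 - real t ^ 2 / V" using V by (simp add: field_simps)
    hence "g a * (1 / 2) \<le> g a * (1 - real t ^ 2 / V)"
      by (intro mult_left_mono) (auto simp: g_def)
    also have "\<dots> \<le> g (a + t)"
      unfolding g_def V_def using gm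
      by (intro binomial_pmf_near_max p k) (simp add: g_def)
    finally show ?thesis by simp
  qed
  have "sqrt (V / 2) * (g a / 2) \<le> real (Suc T) * (g a / 2)"
    using T2 by (intro mult_right_mono) (auto simp: g_def)
  also have "\<dots> = (\<Sum>t\<le>T. g a / 2)" by simp
  also have "\<dots> \<le> (\<Sum>t\<le>T. g (a + t))"
    by (intro sum_mono half) auto
  also have "\<dots> = (\<Sum>b\<in>(+) a ` {..T}. g b)"
    by (subst sum.reindex) auto
  also have "\<dots> \<le> 1"
    unfolding g_def by (simp add: measure_measure_pmf_finite[symmetric])
  finally have "sqrt (V / 2) * g a \<le> 2" by simp
  hence "sqrt V * g a \<le> 2 * sqrt 2" by (simp add: real_sqrt_divide field_simps)
  also have "\<dots> \<le> 4" by (simp add: real_le_lsqrt)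
  finally have "g a \<le> 4 / sqrt V" using V by (simp add: field_simps)
  thus ?thesis
    using gm[of b] by (simp add: g_def V_def)
qed

subsection \<open>Perturbed lattices\<close>

text \<open>Indices are selected rather than vectors, and injectively, because each index stands for
  its own block of coordinates.\<close>

lemma spanning_subfamily:
  fixes v :: "'i \<Rightarrow> real ^ 'd"
  assumes "span (v ` A) = UNIV"
  obtains \<iota> :: "'d \<Rightarrow> 'i" where "inj \<iota>" "range \<iota> \<subseteq> A" "span (range (v \<circ> \<iota>)) = UNIV"
proof -
  obtain B where B: "B \<subseteq> v ` A" "independent B" "v ` A \<subseteq> span B"
    using maximal_independent_subset[of "v ` A"] by blast
  have sB: "span B = UNIV"
    using B(3) assms span_minimal[OF B(3) subspace_span] by auto
  have "card B = dim (UNIV :: (real ^ 'd) set)"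
    using basis_card_eq_dim[of B UNIV] B(2) sB by simp
  hence "card (UNIV :: 'd set) = card B" by simp
  moreover have "finite B" using B(2) independent_imp_finite by blast
  ultimately obtain \<beta> :: "'d \<Rightarrow> real ^ 'd" where \<beta>: "bij_betw \<beta> UNIV B"
    using finite_same_card_bij[of "UNIV :: 'd set" B] by auto
  have "\<beta> k \<in> v ` A" for k
    using B(1) bij_betwE[OF \<beta>] by blast
  hence "\<forall>k. \<exists>i\<in>A. v i = \<beta> k"
    by (metis imageE)
  then obtain \<iota> where \<iota>: "\<And>k. \<iota> k \<in> A" "\<And>k. v (\<iota> k) = \<beta> k" by metis
  have "inj \<beta>" using \<beta> by (simp add: bij_betw_def)
  hence "inj \<iota>" by (metis \<iota>(2) injD injI)
  moreover have "range (v \<circ> \<iota>) = B" using \<iota>(2) \<beta> by (auto simp: bij_betw_def)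
  ultimately show ?thesis using that[of \<iota>] \<iota>(1) sB by auto
qed

lemma fun_upd_chain_lipschitz:
  fixes H :: "('i \<Rightarrow> nat) \<Rightarrow> 'v::euclidean_space"
  assumes interval: "\<And>k x y z. x \<in> W k \<Longrightarrow> z \<in> W k \<Longrightarrow> x \<le> y \<Longrightarrow> y \<le> z \<Longrightarrow> y \<in> W k"
    and step: "\<And>a k. (\<And>l. a l \<in> W l) \<Longrightarrow> Suc (a k) \<in> W k \<Longrightarrow>
                 infnorm (H (a(k := Suc (a k))) - H a) \<le> r"
    and a: "\<And>l. a l \<in> W l" and xy: "x \<in> W k" "y \<in> W k" "x \<le> y"
  shows "infnorm (H (a(k := y)) - H (a(k := x))) \<le> r * (real y - real x)"
  using xy(3)
proof (induction rule: dec_induct)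
  case base
  thus ?case by (simp add: infnorm_0)
next
  case (step z)
  have z: "z \<in> W k" "Suc z \<in> W k"
    using interval[OF xy(1,2)] step.hyps by auto
  have "infnorm (H ((a(k := z))(k := Suc ((a(k := z)) k))) - H (a(k := z))) \<le> r"
    using z a by (intro assms(2)) auto
  hence "infnorm (H (a(k := Suc z)) - H (a(k := z))) \<le> r"
    by simp
  moreover have "infnorm (H (a(k := Suc z)) - H (a(k := x)))
      \<le> infnorm (H (a(k := Suc z)) - H (a(k := z))) + infnorm (H (a(k := z)) - H (a(k := x)))"
    using infnorm_triangle[of "H (a(k := Suc z)) - H (a(k := z))" "H (a(k := z)) - H (a(k := x))"]
    by simp
  ultimately have "infnorm (H (a(k := Suc z)) - H (a(k := x))) \<le> r + r * (real z - real x)"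
    using step.IH by linarith
  thus ?case by (simp only: of_nat_Suc ring_distribs)
qed

text \<open>Walk from \<open>b\<close> to \<open>a\<close>, changing one coordinate at a time. Each
  coordinate met on the way lies between two values of \<open>W k\<close>, so the walk never leaves
  the box and every unit step costs at most \<open>r\<close>.\<close>

lemma box_lipschitz:
  fixes H :: "('i::finite \<Rightarrow> nat) \<Rightarrow> 'v::euclidean_space"
  assumes interval: "\<And>k x y z. x \<in> W k \<Longrightarrow> z \<in> W k \<Longrightarrow> x \<le> y \<Longrightarrow> y \<le> z \<Longrightarrow> y \<in> W k"
    and step: "\<And>a k. (\<And>l. a l \<in> W l) \<Longrightarrow> Suc (a k) \<in> W k \<Longrightarrow>
                 infnorm (H (a(k := Suc (a k))) - H a) \<le> r"
    and a: "\<And>l. a l \<in> W l" and b: "\<And>l. b l \<in> W l"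
  shows "infnorm (H a - H b) \<le> r * (\<Sum>k\<in>UNIV. \<bar>real (a k) - real (b k)\<bar>)"
proof -
  have coord: "infnorm (H (b(k := x)) - H b) \<le> r * \<bar>real x - real (b k)\<bar>"
    if "\<And>l. b l \<in> W l" "x \<in> W k" for b k x
  proof (cases "b k \<le> x")
    case True
    have "infnorm (H (b(k := x)) - H (b(k := b k))) \<le> r * (real x - real (b k))"
      using interval step that(1,1,2) True by (rule fun_upd_chain_lipschitz)
    thus ?thesis using True by simp
  next
    case False
    hence "x \<le> b k" by simp
    with interval step that(1,2) that(1)
    have "infnorm (H (b(k := b k)) - H (b(k := x))) \<le> r * (real (b k) - real x)"
      by (rule fun_upd_chain_lipschitz)
    thus ?thesis using False by (simp add: infnorm_sub[of "H (b(k := x))"])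
  qed
  \<comment> \<open>The induction is on a set containing the coordinates where the points still
    differ, with the starting point \<open>b\<close> left free.\<close>
  have "infnorm (H a - H b) \<le> r * (\<Sum>k\<in>K. \<bar>real (a k) - real (b k)\<bar>)"
    if "{k. a k \<noteq> b k} \<subseteq> K" "\<And>l. b l \<in> W l" for K b
    using finite[of K] that
  proof (induction K arbitrary: b rule: finite_induct)
    case empty
    hence "a = b" by auto
    thus ?case by (simp add: infnorm_0)
  next
    case (insert k K)
    define b' where "b' = b(k := a k)"
    have "infnorm (H a - H b') \<le> r * (\<Sum>l\<in>K. \<bar>real (a l) - real (b' l)\<bar>)"
      using insert.prems a by (intro insert.IH) (auto simp: b'_def)
    also have "(\<Sum>l\<in>K. \<bar>real (a l) - real (b' l)\<bar>) = (\<Sum>l\<in>K. \<bar>real (a l) - real (b l)\<bar>)"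
      using insert.hyps by (intro sum.cong) (auto simp: b'_def)
    finally have "infnorm (H a - H b') \<le> r * (\<Sum>l\<in>K. \<bar>real (a l) - real (b l)\<bar>)" .
    moreover have "infnorm (H b' - H b) \<le> r * \<bar>real (a k) - real (b k)\<bar>"
      unfolding b'_def using a insert.prems by (intro coord) auto
    moreover have "infnorm (H a - H b) \<le> infnorm (H a - H b') + infnorm (H b' - H b)"
      using infnorm_triangle[of "H a - H b'" "H b' - H b"] by simp
    ultimately show ?case using insert.hyps by (simp add: algebra_simps)
  qed
  thus ?thesis using b by blast
qed

text \<open>The set lies in a cube of side \<open>L + 1\<close> whose corner is the coordinatewise
  minimum; this corner need not belong to \<open>T\<close>.\<close>

lemma card_le_of_bounded_diff:
  fixes T :: "('i::finite \<Rightarrow> nat) set"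
  assumes "\<And>a b k. a \<in> T \<Longrightarrow> b \<in> T \<Longrightarrow> a k \<le> b k + L"
  shows "finite T \<and> card T \<le> (L + 1) ^ CARD('i)"
proof (cases "T = {}")
  case False
  define lo where "lo k = (LEAST x. \<exists>a\<in>T. a k = x)" for k
  have lo: "\<exists>a\<in>T. a k = lo k" for k
    unfolding lo_def by (rule LeastI_ex) (use False in blast)
  have "lo k \<le> a k" if "a \<in> T" for a k
    unfolding lo_def by (rule Least_le) (use that in blast)
  moreover have "a k \<le> lo k + L" if "a \<in> T" for a k
    using lo[of k] assms that by metis
  ultimately have sub: "T \<subseteq> (\<Pi>\<^sub>E k\<in>UNIV. {lo k..lo k + L})"
    by (auto simp: PiE_def)
  have fin: "finite (\<Pi>\<^sub>E k\<in>(UNIV :: 'i set). {lo k..lo k + L})"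
    by (intro finite_PiE) auto
  have "card T \<le> card (\<Pi>\<^sub>E k\<in>(UNIV :: 'i set). {lo k..lo k + L})"
    by (intro card_mono fin sub)
  also have "\<dots> = (L + 1) ^ CARD('i)"
    by (simp add: card_PiE)
  finally show ?thesis using finite_subset[OF sub fin] by blast
qed simp

text \<open>The linear map sending coefficients to combinations is surjective, hence injective by
  equality of dimensions, hence bounded below in the Euclidean norm. Passing to
  \<open>infnorm\<close> costs the square root of the dimension.\<close>

lemma spanning_family_bounded_below:
  fixes w :: "'d::finite \<Rightarrow> real ^ 'd"
  assumes "span (range w) = UNIV"
  obtains \<kappa> where "\<kappa> > 0"
    "\<And>(t :: 'd \<Rightarrow> real) k. \<kappa> * \<bar>t k\<bar> \<le> infnorm (\<Sum>k\<in>UNIV. t k *\<^sub>R w k)"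
proof -
  define T where "T = (\<lambda>t :: real ^ 'd. \<Sum>k\<in>UNIV. (t $ k) *\<^sub>R w k)"
  have lin: "linear T"
    unfolding T_def
    by (intro linearI) (simp_all add: scaleR_add_left sum.distrib scaleR_sum_right)
  have "w k \<in> range T" for k
  proof -
    have "T (axis k 1) = (\<Sum>l\<in>UNIV. if l = k then w l else 0)"
      unfolding T_def by (intro sum.cong) (auto simp: axis_def)
    hence "T (axis k 1) = w k" by simp
    thus ?thesis by (metis rangeI)
  qed
  hence "span (range w) \<subseteq> range T"
    by (intro span_minimal linear_subspace_image lin) auto
  hence "surj T" using assms by auto
  hence "inj T" using lin linear_surjective_imp_injective by blast
  then obtain B where B: "B > 0" "\<And>x. B * norm x \<le> norm (T x)"
    using linear_inj_bounded_below_pos[OF lin] by blast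
  define S where "S = sqrt (real DIM(real ^ 'd))"
  have S: "S > 0" unfolding S_def by simp
  have "B / S * \<bar>t k\<bar> \<le> infnorm (\<Sum>k\<in>UNIV. t k *\<^sub>R w k)" for t :: "'d \<Rightarrow> real" and k
  proof -
    have "B * \<bar>t k\<bar> \<le> B * norm (\<chi> k. t k)"
      using component_le_norm_cart[of "\<chi> k. t k" k] B(1) by (intro mult_left_mono) auto
    also have "\<dots> \<le> norm (T (\<chi> k. t k))" by (rule B)
    also have "\<dots> \<le> S * infnorm (T (\<chi> k. t k))"
      unfolding S_def by (rule norm_le_infnorm)
    finally show ?thesis using S by (simp add: T_def field_simps)
  qed
  thus ?thesis using that[of "B / S"] B S by simp
qed

text \<open>\<open>F\<close> is a linear map plus an error \<open>H\<close> that changes by at most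
  \<open>r\<close> per grid edge. The smallness of \<open>r\<close> makes the error at most half of
  what the linear part separates, so two points with images in one ball of radius \<open>R\<close>
  have coordinates within \<open>4 * R / (\<kappa> * s)\<close> of each other.\<close>

lemma card_quasi_isometric_grid_le:
  fixes F :: "('d::finite \<Rightarrow> nat) \<Rightarrow> real ^ 'd" and w :: "'d \<Rightarrow> real ^ 'd"
  assumes interval: "\<And>k x y z. x \<in> W k \<Longrightarrow> z \<in> W k \<Longrightarrow> x \<le> y \<Longrightarrow> y \<le> z \<Longrightarrow> y \<in> W k"
    and step: "\<And>a k. (\<And>l. a l \<in> W l) \<Longrightarrow> Suc (a k) \<in> W k \<Longrightarrow>
                 infnorm (F (a(k := Suc (a k))) - F a - s *\<^sub>R w k) \<le> r"
    and \<kappa>: "\<And>(t :: 'd \<Rightarrow> real) k. \<kappa> * \<bar>t k\<bar> \<le> infnorm (\<Sum>k\<in>UNIV. t k *\<^sub>R w k)"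
    and pos: "\<kappa> > 0" "s > 0" "r \<ge> 0" "R \<ge> 0"
    and small: "r * real CARD('d) \<le> \<kappa> * s / 2"
  shows "real (card {a. (\<forall>k. a k \<in> W k) \<and> infnorm (F a - x) < R})
           \<le> (4 * R / (\<kappa> * s) + 1) ^ CARD('d)"
proof -
  define H where "H a = F a - (\<Sum>k\<in>UNIV. (s * real (a k)) *\<^sub>R w k)" for a
  define T where "T = {a. (\<forall>k. a k \<in> W k) \<and> infnorm (F a - x) < R}"
  define L where "L = nat \<lfloor>4 * R / (\<kappa> * s)\<rfloor>"
  have L0: "0 \<le> 4 * R / (\<kappa> * s)" using pos by simp
  have stepH: "infnorm (H (a(k := Suc (a k))) - H a) \<le> r"
    if "\<And>l. a l \<in> W l" "Suc (a k) \<in> W k" for a k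
  proof -
    have "(\<Sum>l\<in>UNIV. (s * real ((a(k := Suc (a k))) l)) *\<^sub>R w l)
        = (\<Sum>l\<in>UNIV. (s * real (a l)) *\<^sub>R w l + (if l = k then s *\<^sub>R w k else 0))"
      by (intro sum.cong) (auto simp: algebra_simps)
    also have "\<dots> = (\<Sum>l\<in>UNIV. (s * real (a l)) *\<^sub>R w l) + s *\<^sub>R w k"
      by (simp add: sum.distrib)
    finally have "H (a(k := Suc (a k))) - H a = F (a(k := Suc (a k))) - F a - s *\<^sub>R w k"
      by (simp add: H_def)
    thus ?thesis using step[OF that] by simp
  qed
  have "a k \<le> b k + L" if ab: "a \<in> T" "b \<in> T" for a b k
  proof -
    define m where "m l = \<bar>real (a l) - real (b l)\<bar>" for l
    \<comment> \<open>Working at the coordinate with the largest difference lets the sum in the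
      Lipschitz bound be replaced by \<open>CARD('d)\<close> times this difference, which can then
      be absorbed on the left.\<close>
    have "Max (range m) \<in> range m" by (intro Max_in) auto
    then obtain k0 where k0: "m k0 = Max (range m)" by (metis imageE)
    have mk: "m l \<le> m k0" for l unfolding k0 by (intro Max_ge) auto
    have "\<And>l. a l \<in> W l" "\<And>l. b l \<in> W l" using ab by (auto simp: T_def)
    with interval stepH
    have "infnorm (H a - H b) \<le> r * (\<Sum>l\<in>UNIV. \<bar>real (a l) - real (b l)\<bar>)"
      by (rule box_lipschitz)
    also have "\<dots> \<le> r * (\<Sum>l\<in>(UNIV :: 'd set). m k0)"
      using pos mk by (intro mult_left_mono sum_mono) (auto simp: m_def)
    also have "\<dots> = (r * real CARD('d)) * m k0"
      by simp
    also have "\<dots> \<le> (\<kappa> * s / 2) * m k0"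
      by (intro mult_right_mono small) (simp add: m_def)
    finally have 1: "infnorm (H a - H b) \<le> \<kappa> * s / 2 * m k0" .
    have "infnorm (F a - F b) \<le> infnorm (F a - x) + infnorm (F b - x)"
      using infnorm_triangle[of "F a - x" "x - F b"] by (simp add: infnorm_sub)
    hence 2: "infnorm (F a - F b) \<le> 2 * R" using ab by (simp add: T_def)
    have eq: "(F a - F b) - (H a - H b) = (\<Sum>l\<in>UNIV. (s * (real (a l) - real (b l))) *\<^sub>R w l)"
      by (simp add: H_def sum_subtractf[symmetric] algebra_simps)
    have "\<kappa> * \<bar>s * (real (a k0) - real (b k0))\<bar> \<le> infnorm ((F a - F b) - (H a - H b))"
      unfolding eq by (rule \<kappa>)
    moreover have "infnorm ((F a - F b) - (H a - H b)) \<le> infnorm (F a - F b) + infnorm (H a - H b)"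
      using infnorm_triangle[of "F a - F b" "- (H a - H b)"] infnorm_neg[of "H a - H b"]
      by (simp only: diff_conv_add_uminus)
    moreover have "\<kappa> * \<bar>s * (real (a k0) - real (b k0))\<bar> = \<kappa> * s * m k0"
      using pos by (simp add: abs_mult m_def)
    ultimately have "\<kappa> * s * m k0 \<le> 2 * R + \<kappa> * s / 2 * m k0"
      using 1 2 by linarith
    hence "m k0 \<le> 4 * R / (\<kappa> * s)"
      using pos by (simp add: field_simps)
    hence "m k \<le> 4 * R / (\<kappa> * s)" using mk[of k] by linarith
    hence "real (a k) - real (b k) \<le> 4 * R / (\<kappa> * s)" by (simp add: m_def)
    hence "int (a k) - int (b k) \<le> \<lfloor>4 * R / (\<kappa> * s)\<rfloor>"
      by (subst le_floor_iff) simp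
    thus ?thesis unfolding L_def by linarith
  qed
  hence "card T \<le> (L + 1) ^ CARD('d)"
    using card_le_of_bounded_diff[of T L] by blast
  hence "real (card T) \<le> real ((L + 1) ^ CARD('d))"
    by (rule of_nat_mono)
  also have "\<dots> = (real L + 1) ^ CARD('d)"
    by (simp add: add.commute)
  also have "\<dots> \<le> (4 * R / (\<kappa> * s) + 1) ^ CARD('d)"
    using L0 unfolding L_def by (intro power_mono) auto
  finally show ?thesis by (simp add: T_def)
qed

subsection \<open>Random monotone grids in the cube\<close>

text \<open>Fubini. It serves to freeze the permutation and the coordinates outside the blocks while
  the counts stay random.\<close>

lemma prob_pair_pmf_le:
  assumes "\<And>x. x \<in> set_pmf A \<Longrightarrow> measure_pmf.prob B {y. (x, y) \<in> S} \<le> t"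
  shows "measure_pmf.prob (pair_pmf A B) S \<le> t"
proof -
  have t: "0 \<le> t"
    using assms set_pmf_not_empty[of A] measure_nonneg by (meson ex_in_conv order_trans)
  have "emeasure (pair_pmf A B) S = (\<integral>\<^sup>+z. indicator S z \<partial>pair_pmf A B)"
    by simp
  also have "\<dots> = (\<integral>\<^sup>+x. \<integral>\<^sup>+y. indicator S (x, y) \<partial>B \<partial>A)"
    by (rule nn_integral_pair_pmf')
  also have "\<dots> = (\<integral>\<^sup>+x. \<integral>\<^sup>+y. indicator {y. (x, y) \<in> S} y \<partial>B \<partial>A)"
    by (simp add: indicator_def)
  also have "\<dots> = (\<integral>\<^sup>+x. ennreal (measure_pmf.prob B {y. (x, y) \<in> S}) \<partial>A)"
    by (simp add: measure_pmf.emeasure_eq_measure)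
  also have "\<dots> \<le> (\<integral>\<^sup>+x. ennreal t \<partial>A)"
    using assms by (intro nn_integral_mono_AE) (auto simp: AE_measure_pmf_iff intro: ennreal_leI)
  also have "\<dots> = ennreal t"
    by simp
  finally show ?thesis
    using t by (simp add: measure_pmf.emeasure_eq_measure)
qed

lemma ex_bij_betw_matching_predicates:
  assumes "finite A" "card {x\<in>A. P x} = card {x\<in>A. Q x}"
  shows "\<exists>h. bij_betw h A A \<and> (\<forall>x\<in>A. P x \<longleftrightarrow> Q (h x))"
proof -
  have "card (A - {x\<in>A. P x}) = card (A - {x\<in>A. Q x})"
    using assms by (subst (1 2) card_Diff_subset) auto
  moreover have "A - {x\<in>A. P x} = {x\<in>A. \<not> P x}" "A - {x\<in>A. Q x} = {x\<in>A. \<not> Q x}"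
    by auto
  ultimately have "card {x\<in>A. \<not> P x} = card {x\<in>A. \<not> Q x}"
    by simp
  then obtain g where g: "bij_betw g {x\<in>A. \<not> P x} {x\<in>A. \<not> Q x}"
    using finite_same_card_bij[of "{x\<in>A. \<not> P x}" "{x\<in>A. \<not> Q x}"] assms(1) by auto
  obtain f where f: "bij_betw f {x\<in>A. P x} {x\<in>A. Q x}"
    using finite_same_card_bij[of "{x\<in>A. P x}" "{x\<in>A. Q x}"] assms by auto
  define h where "h x = (if P x then f x else g x)" for x
  have "bij_betw h {x\<in>A. P x} {x\<in>A. Q x}"
    using f by (subst bij_betw_cong[of _ h f]) (auto simp: h_def)
  moreover have "bij_betw h {x\<in>A. \<not> P x} {x\<in>A. \<not> Q x}"
    using g by (subst bij_betw_cong[of _ h g]) (auto simp: h_def)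
  ultimately have "bij_betw h ({x\<in>A. P x} \<union> {x\<in>A. \<not> P x}) ({x\<in>A. Q x} \<union> {x\<in>A. \<not> Q x})"
    by (rule bij_betw_combine) auto
  moreover have "{x\<in>A. P x} \<union> {x\<in>A. \<not> P x} = A" "{x\<in>A. Q x} \<union> {x\<in>A. \<not> Q x} = A"
    by auto
  moreover have "P x \<longleftrightarrow> Q (h x)" if "x \<in> A" for x
    using bij_betwE[OF f] bij_betwE[OF g] that by (auto simp: h_def)
  ultimately show ?thesis by metis
qed

text \<open>Disjoint blocks of independent bits have independent counts. Adding a block splits the
  product measure in two, and a single block contributes a binomial variable.\<close>

lemma map_pmf_card_blocks:
  assumes K: "finite K" and fin: "\<And>k. k \<in> K \<Longrightarrow> finite (I k)"
    and disj: "disjoint_family_on I K" and p: "p \<in> {0..1}"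
  shows "map_pmf (\<lambda>\<xi> k. if k \<in> K then card {i \<in> I k. \<xi> i} else 0)
           (Pi_pmf (\<Union>k\<in>K. I k) False (\<lambda>_. bernoulli_pmf p))
         = Pi_pmf K 0 (\<lambda>k. binomial_pmf (card (I k)) p)"
  using K fin disj
proof (induction K rule: finite_induct)
  case empty
  show ?case by simp
next
  case (insert k K)
  let ?B = "\<lambda>A. Pi_pmf A False (\<lambda>_. bernoulli_pmf p)"
  let ?N = "\<lambda>K \<xi> k. if k \<in> K then card {i \<in> I k. \<xi> i} else 0"
  have disj': "I k \<inter> (\<Union>k\<in>K. I k) = {}" "disjoint_family_on I K"
    using insert.prems insert.hyps by (auto simp: disjoint_family_on_def)
  have "map_pmf (?N (insert k K)) (?B (\<Union>k\<in>insert k K. I k))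
      = map_pmf (\<lambda>(f, g). ?N (insert k K) (\<lambda>x. if x \<in> I k then f x else g x))
          (pair_pmf (?B (I k)) (?B (\<Union>k\<in>K. I k)))"
    using insert disj' by (simp add: Pi_pmf_union map_pmf_comp case_prod_unfold)
  also have "(\<lambda>(f, g). ?N (insert k K) (\<lambda>x. if x \<in> I k then f x else g x))
      = (\<lambda>(y, a). a(k := y)) \<circ> (\<lambda>(f, g). (card {i \<in> I k. f i}, ?N K g))"
  proof (intro ext)
    fix fg l
    have "{i \<in> I l. if i \<in> I k then fst fg i else snd fg i} = {i \<in> I l. snd fg i}"
      if "l \<in> K"
      using disj'(1) that by auto
    moreover have "{i \<in> I k. if i \<in> I k then fst fg i else snd fg i} = {i \<in> I k. fst fg i}"
      by auto
    ultimately show "(\<lambda>(f, g). ?N (insert k K) (\<lambda>x. if x \<in> I k then f x else g x)) fg l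
      = ((\<lambda>(y, a). a(k := y)) \<circ> (\<lambda>(f, g). (card {i \<in> I k. f i}, ?N K g))) fg l"
      using insert.hyps by (auto simp: case_prod_unfold)
  qed
  also have "map_pmf \<dots> (pair_pmf (?B (I k)) (?B (\<Union>k\<in>K. I k)))
      = map_pmf (\<lambda>(y, a). a(k := y))
          (pair_pmf (map_pmf (\<lambda>f. card {i \<in> I k. f i}) (?B (I k)))
             (map_pmf (?N K) (?B (\<Union>k\<in>K. I k))))"
    by (simp add: map_pair[symmetric] pmf.map_comp)
  also have "map_pmf (?N K) (?B (\<Union>k\<in>K. I k)) = Pi_pmf K 0 (\<lambda>k. binomial_pmf (card (I k)) p)"
    using insert disj' by auto
  also have "map_pmf (\<lambda>f. card {i \<in> I k. f i}) (?B (I k)) = binomial_pmf (card (I k)) p"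
    using insert.prems p by (intro binomial_pmf_altdef'[symmetric]) auto
  finally show ?case
    unfolding Pi_pmf_insert[OF insert.hyps] .
qed

section \<open>Resampling the cube by block-preserving permutations\<close>

locale block_family =
  fixes I :: "'k::finite \<Rightarrow> 'a set" and U :: "'a set" and \<rho> :: "'a \<Rightarrow> nat" and p :: real
  assumes finite_U: "finite U"
    and subset_U: "I k \<subseteq> U"
    and disj: "disjoint_family I"
    and rank: "bij_betw \<rho> (I k) {..<card (I k)}"
    and p01: "0 < p" "p < 1"
begin

definition cube :: "('a \<Rightarrow> bool) pmf" where
  "cube = Pi_pmf U False (\<lambda>_. bernoulli_pmf p)"

definition counts :: "('a \<Rightarrow> bool) \<Rightarrow> 'k \<Rightarrow> nat" where
  "counts \<xi> k = card {i \<in> I k. \<xi> i}"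

definition counts_pmf :: "('k \<Rightarrow> nat) pmf" where
  "counts_pmf = Pi_pmf UNIV 0 (\<lambda>k. binomial_pmf (card (I k)) p)"

text \<open>The sorted configuration with prescribed block counts, as \<open>\<rho>\<close> ranks
  each block starting from 0. Only the values of \<open>\<eta>\<close> off the blocks
  matter.\<close>

definition fill :: "('k \<Rightarrow> nat) \<Rightarrow> ('a \<Rightarrow> bool) \<Rightarrow> 'a \<Rightarrow> bool" where
  "fill a \<eta> i = (if \<exists>k. i \<in> I k then \<exists>k. i \<in> I k \<and> \<rho> i < a k else \<eta> i)"

definition block_perms :: "('a \<Rightarrow> 'a) set" where
  "block_perms = {\<pi>. \<pi> permutes (\<Union>k. I k) \<and> (\<forall>k. \<forall>i\<in>I k. \<pi> i \<in> I k)}"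

lemma finite_I [simp]: "finite (I k)"
  using finite_subset[OF subset_U finite_U] .

lemma block_unique: "i \<in> I k \<Longrightarrow> i \<in> I l \<Longrightarrow> k = l"
  using disj by (auto simp: disjoint_family_on_def)

lemma fill_block: "i \<in> I k \<Longrightarrow> fill a \<eta> i \<longleftrightarrow> \<rho> i < a k"
  using block_unique by (auto simp: fill_def)

lemma finite_block_perms: "finite block_perms"
  unfolding block_perms_def
  by (rule finite_subset[OF _ finite_permutations[of "\<Union>k. I k"]]) auto

lemma block_perms_nonempty: "block_perms \<noteq> {}"
proof -
  have "id \<in> block_perms" by (simp add: block_perms_def permutes_id)
  thus ?thesis by blast
qed

text \<open>Left translation in a finite group; it leaves the uniform distribution on
  \<open>block_perms\<close> invariant.\<close>

lemma bij_betw_comp_block_perms: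
  assumes "\<tau> \<in> block_perms"
  shows "bij_betw (\<lambda>\<pi>. \<tau> \<circ> \<pi>) block_perms block_perms"
proof -
  have "inj \<tau>" using assms by (auto simp: block_perms_def permutes_inj)
  hence inj: "inj_on (\<lambda>\<pi>. \<tau> \<circ> \<pi>) block_perms"
    by (metis fun.inj_map inj_on_subset subset_UNIV)
  moreover have "(\<lambda>\<pi>. \<tau> \<circ> \<pi>) ` block_perms \<subseteq> block_perms"
    using assms by (auto simp: block_perms_def intro: permutes_compose)
  ultimately show ?thesis
    using endo_inj_surj[OF finite_block_perms] by (auto simp: bij_betw_def)
qed

text \<open>In each block \<open>\<xi>\<close> and its sorted version have equally many ones, so a
  bijection of the block matches them. These bijections, extended by the identity, form the
  permutation.\<close>

lemma ex_sorting_perm: "\<exists>\<tau>\<in>block_perms. \<xi> = fill (counts \<xi>) \<xi> \<circ> \<tau>"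
proof -
  have "card {i \<in> I k. \<xi> i} = card {i \<in> I k. \<rho> i < counts \<xi> k}" for k
  proof -
    have le: "counts \<xi> k \<le> card (I k)"
      unfolding counts_def by (intro card_mono) auto
    have "bij_betw \<rho> {i \<in> I k. \<rho> i < counts \<xi> k} {..<counts \<xi> k}"
    proof (rule bij_betw_subset[OF rank[of k]])
      have "\<exists>i\<in>I k. x = \<rho> i" if "x < counts \<xi> k" for x
        using rank[of k] le that by (auto simp: bij_betw_def set_eq_iff image_iff)
      thus "\<rho> ` {i \<in> I k. \<rho> i < counts \<xi> k} = {..<counts \<xi> k}" by auto
    qed auto
    from bij_betw_same_card[OF this] show ?thesis
      by (simp add: counts_def)
  qed
  hence "\<exists>h. bij_betw h (I k) (I k) \<and> (\<forall>i\<in>I k. \<xi> i \<longleftrightarrow> \<rho> (h i) < counts \<xi> k)" for k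
    by (intro ex_bij_betw_matching_predicates) auto
  then obtain h where h: "\<And>k. bij_betw (h k) (I k) (I k)"
      "\<And>k i. i \<in> I k \<Longrightarrow> \<xi> i \<longleftrightarrow> \<rho> (h k i) < counts \<xi> k"
    by metis
  define \<tau> where "\<tau> i = (if \<exists>k. i \<in> I k then h (THE k. i \<in> I k) i else i)" for i
  have \<tau>: "\<tau> i = h k i" if "i \<in> I k" for i k
  proof -
    have "(THE k. i \<in> I k) = k" using that block_unique by blast
    thus ?thesis using that by (auto simp: \<tau>_def)
  qed
  have \<tau>I: "\<tau> i \<in> I k" if "i \<in> I k" for i k
    using \<tau>[OF that] bij_betwE[OF h(1)] that by simp
  have inj: "inj_on \<tau> (\<Union>k. I k)"
  proof (rule inj_onI, clarify)
    fix i j k l assume *: "i \<in> I k" "j \<in> I l" "\<tau> i = \<tau> j"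
    hence "k = l" using \<tau>I block_unique by metis
    thus "i = j" using * \<tau> h(1)[of k] by (auto simp: bij_betw_def inj_on_def)
  qed
  have "\<tau> ` (\<Union>k. I k) \<subseteq> (\<Union>k. I k)" using \<tau>I by blast
  hence "bij_betw \<tau> (\<Union>k. I k) (\<Union>k. I k)"
    using inj endo_inj_surj[of "\<Union>k. I k" \<tau>] by (auto simp: bij_betw_def)
  hence "\<tau> permutes (\<Union>k. I k)"
    by (rule bij_imp_permutes) (auto simp: \<tau>_def)
  hence "\<tau> \<in> block_perms" using \<tau>I by (auto simp: block_perms_def)
  moreover have "\<xi> = fill (counts \<xi>) \<xi> \<circ> \<tau>"
  proof
    fix i
    show "\<xi> i = (fill (counts \<xi>) \<xi> \<circ> \<tau>) i"
    proof (cases "\<exists>k. i \<in> I k")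
      case True
      then obtain k where k: "i \<in> I k" by blast
      show ?thesis using fill_block[OF \<tau>I[OF k]] h(2)[OF k] \<tau>[OF k] by simp
    next
      case False
      thus ?thesis by (simp add: \<tau>_def fill_def)
    qed
  qed
  ultimately show ?thesis by blast
qed

lemma map_pmf_comp_perm:
  assumes "\<pi> \<in> block_perms"
  shows "map_pmf (\<lambda>\<xi>. \<xi> \<circ> \<pi>) cube = cube"
proof -
  have "\<pi> permutes U"
    using assms subset_U by (auto simp: block_perms_def intro: permutes_subset)
  thus ?thesis
    unfolding cube_def using finite_U
    by (intro Pi_pmf_bij_betw[symmetric]) (auto simp: permutes_imp_bij permutes_in_image)
qed

text \<open>The counts depend on the block coordinates only and \<open>fill\<close> reads
  \<open>\<eta>\<close> only off the blocks. These parts are independent, so \<open>\<eta>\<close>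
  may come from a fresh copy of the cube.\<close>

lemma map_pmf_fill_counts:
  "map_pmf (\<lambda>\<xi>. fill (counts \<xi>) \<xi>) cube = map_pmf (\<lambda>(a, \<eta>). fill a \<eta>) (pair_pmf counts_pmf cube)"
proof -
  let ?J = "\<Union>k. I k"
  let ?B = "\<lambda>A. Pi_pmf A False (\<lambda>_. bernoulli_pmf p)"
  let ?rest = "\<lambda>\<eta> x. if x \<in> U - ?J then \<eta> x else False"
  have U: "U = ?J \<union> (U - ?J)" using subset_U by blast
  have cube: "cube = map_pmf (\<lambda>(f, g) x. if x \<in> ?J then f x else g x) (pair_pmf (?B ?J) (?B (U - ?J)))"
    unfolding cube_def
    by (subst U, subst Pi_pmf_union) (use finite_U in auto)
  have counts: "map_pmf counts (?B ?J) = counts_pmf"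
    using map_pmf_card_blocks[of UNIV I p] disj p01
    by (simp add: counts_pmf_def counts_def[abs_def])
  have "map_pmf (\<lambda>\<xi>. fill (counts \<xi>) \<xi>) cube
      = map_pmf (\<lambda>(f, g). fill (counts f) g) (pair_pmf (?B ?J) (?B (U - ?J)))"
  proof -
    have "fill (counts (\<lambda>x. if x \<in> ?J then f x else g x)) (\<lambda>x. if x \<in> ?J then f x else g x)
            = fill (counts f) g" for f g :: "'a \<Rightarrow> bool"
    proof -
      have "{i \<in> I k. if i \<in> ?J then f i else g i} = {i \<in> I k. f i}" for k by auto
      hence "counts (\<lambda>x. if x \<in> ?J then f x else g x) = counts f"
        by (simp add: counts_def[abs_def])
      thus ?thesis by (auto simp: fill_def[abs_def])
    qed
    thus ?thesis by (simp add: cube map_pmf_comp case_prod_unfold)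
  qed
  also have "\<dots> = map_pmf (\<lambda>(a, \<eta>). fill a \<eta>) (pair_pmf counts_pmf (?B (U - ?J)))"
    by (simp add: counts[symmetric] pair_map_pmf1 pmf.map_comp o_def case_prod_unfold)
  also have "?B (U - ?J) = map_pmf ?rest cube"
    unfolding cube_def using finite_U by (intro Pi_pmf_subset) auto
  also have "map_pmf (\<lambda>(a, \<eta>). fill a \<eta>) (pair_pmf counts_pmf (map_pmf ?rest cube))
      = map_pmf (\<lambda>(a, \<eta>). fill a (?rest \<eta>)) (pair_pmf counts_pmf cube)"
    by (simp add: pair_map_pmf2 pmf.map_comp o_def case_prod_unfold)
  \<comment> \<open>Erasing the block coordinates of \<open>\<eta>\<close> is invisible to
    \<open>fill\<close>, and outside \<open>U\<close> the value is \<open>False\<close> almost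
    surely.\<close>
  also have "\<dots> = map_pmf (\<lambda>(a, \<eta>). fill a \<eta>) (pair_pmf counts_pmf cube)"
  proof (intro map_pmf_cong refl, clarify)
    fix a \<eta> assume "(a, \<eta>) \<in> set_pmf (pair_pmf counts_pmf cube)"
    hence "\<eta> x = False" if "x \<notin> U" for x
      using set_Pi_pmf_subset[OF finite_U, of False "\<lambda>_. bernoulli_pmf p"] that
      by (auto simp: cube_def)
    thus "fill a (?rest \<eta>) = fill a \<eta>" by (auto simp: fill_def[abs_def])
  qed
  finally show ?thesis .
qed

text \<open>A uniform block permutation cannot distinguish \<open>\<xi>\<close> from its sorted
  version, and it preserves the law of the cube. Pairing \<open>\<pi>\<close> with
  \<open>\<eta>\<close> first displays the counts \<open>a\<close> as independent of both.\<close>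

lemma cube_conv_random_fill:
  "cube = map_pmf (\<lambda>((\<pi>, \<eta>), a). fill a \<eta> \<circ> \<pi>)
            (pair_pmf (pair_pmf (pmf_of_set block_perms) cube) counts_pmf)"
proof -
  let ?G = "pmf_of_set block_perms"
  have set_G: "set_pmf ?G = block_perms"
    by (simp add: finite_block_perms block_perms_nonempty)
  have orbit: "map_pmf (\<lambda>\<pi>. fill (counts \<xi>) \<xi> \<circ> \<pi>) ?G = map_pmf (\<lambda>\<pi>. \<xi> \<circ> \<pi>) ?G" for \<xi>
  proof -
    obtain \<tau> where \<tau>: "\<tau> \<in> block_perms" "\<xi> = fill (counts \<xi>) \<xi> \<circ> \<tau>"
      using ex_sorting_perm by blast
    have "?G = map_pmf (\<lambda>\<pi>. \<tau> \<circ> \<pi>) ?G"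
      using bij_betw_comp_block_perms[OF \<tau>(1)] block_perms_nonempty finite_block_perms
      by (intro map_pmf_of_set_bij_betw[symmetric])
    hence "map_pmf (\<lambda>\<pi>. fill (counts \<xi>) \<xi> \<circ> \<pi>) ?G
        = map_pmf (\<lambda>\<pi>. fill (counts \<xi>) \<xi> \<circ> \<pi>) (map_pmf (\<lambda>\<pi>. \<tau> \<circ> \<pi>) ?G)"
      by simp
    also have "\<dots> = map_pmf (\<lambda>\<pi>. (fill (counts \<xi>) \<xi> \<circ> \<tau>) \<circ> \<pi>) ?G"
      by (simp add: pmf.map_comp comp_assoc o_def)
    finally show ?thesis using \<tau>(2) by simp
  qed
  have "map_pmf (\<lambda>((\<pi>, \<eta>), a). fill a \<eta> \<circ> \<pi>) (pair_pmf (pair_pmf ?G cube) counts_pmf)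
      = bind_pmf ?G (\<lambda>\<pi>. map_pmf (\<lambda>\<xi>. \<xi> \<circ> \<pi>) (map_pmf (\<lambda>(a, \<eta>). fill a \<eta>) (pair_pmf counts_pmf cube)))"
    by (subst pair_commute_pmf[of counts_pmf])
       (simp add: pair_pmf_def map_pmf_def bind_assoc_pmf bind_return_pmf)
  also have "\<dots> = bind_pmf ?G (\<lambda>\<pi>. map_pmf (\<lambda>\<xi>. fill (counts \<xi>) \<xi> \<circ> \<pi>) cube)"
    by (simp add: map_pmf_fill_counts[symmetric] pmf.map_comp o_def)
  \<comment> \<open>Exchanging the order of sampling gives access to the orbit of one fixed
    \<open>\<xi>\<close>; the exchange is undone afterwards.\<close>
  also have "\<dots> = bind_pmf cube (\<lambda>\<xi>. map_pmf (\<lambda>\<pi>. fill (counts \<xi>) \<xi> \<circ> \<pi>) ?G)"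
    unfolding map_pmf_def by (rule bind_commute_pmf)
  also have "\<dots> = bind_pmf cube (\<lambda>\<xi>. map_pmf (\<lambda>\<pi>. \<xi> \<circ> \<pi>) ?G)"
    by (simp add: orbit)
  also have "\<dots> = bind_pmf ?G (\<lambda>\<pi>. map_pmf (\<lambda>\<xi>. \<xi> \<circ> \<pi>) cube)"
    unfolding map_pmf_def by (rule bind_commute_pmf)
  also have "\<dots> = bind_pmf ?G (\<lambda>_. cube)"
    by (intro bind_pmf_cong refl) (simp add: set_G map_pmf_comp_perm)
  finally show ?thesis by simp
qed

end

section \<open>Grid edges and conditioning on the counts\<close>

context block_family
begin

text \<open>The increment switches on the block element of rank \<open>a k\<close>, and
  \<open>i\<close> is its preimage under \<open>\<pi>\<close>. The last equation records that
  coordinate \<open>i\<close> was off, so that the edge is exactly a discrete derivative at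
  \<open>i\<close>.\<close>

lemma fill_Suc_conv_fun_upd:
  assumes \<pi>: "\<pi> \<in> block_perms" and a: "a k < card (I k)"
  obtains i where "i \<in> I k"
    "fill (a(k := Suc (a k))) \<eta> \<circ> \<pi> = (fill a \<eta> \<circ> \<pi>)(i := True)"
    "fill a \<eta> \<circ> \<pi> = (fill a \<eta> \<circ> \<pi>)(i := False)"
proof -
  have "a k \<in> \<rho> ` I k" using rank[of k] a by (simp add: bij_betw_def)
  then obtain j where j: "j \<in> I k" "\<rho> j = a k" by auto
  have \<pi>J: "\<pi> permutes (\<Union>k. I k)" and \<pi>I: "\<And>l i. i \<in> I l \<Longrightarrow> \<pi> i \<in> I l"
    using \<pi> by (auto simp: block_perms_def)
  obtain i where i: "\<pi> i = j" using permutes_surj[OF \<pi>J] by (metis surjD)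
  have "i \<in> (\<Union>k. I k)"
    using permutes_in_image[OF \<pi>J, of i] i j by blast
  then obtain l where l: "i \<in> I l" by blast
  hence ik: "i \<in> I k" using \<pi>I[OF l] i j block_unique by metis
  have other: "fill (a(k := Suc (a k))) \<eta> j' = fill a \<eta> j'" if "j' \<noteq> j" for j'
  proof (cases "\<exists>l. j' \<in> I l")
    case True
    then obtain l where l: "j' \<in> I l" by blast
    have "\<rho> j' \<noteq> a k" if "l = k"
      using rank[of k] l j \<open>j' \<noteq> j\<close> that by (auto simp: bij_betw_def inj_on_def)
    thus ?thesis using fill_block[OF l] by auto
  next
    case False
    thus ?thesis by (simp add: fill_def)
  qed
  have inj: "\<pi> i' = j \<longleftrightarrow> i' = i" for i'
    using permutes_inj[OF \<pi>J] i by (auto simp: inj_eq)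
  show ?thesis
  proof (rule that[OF ik])
    show "fill (a(k := Suc (a k))) \<eta> \<circ> \<pi> = (fill a \<eta> \<circ> \<pi>)(i := True)"
    proof
      fix i'
      show "(fill (a(k := Suc (a k))) \<eta> \<circ> \<pi>) i' = ((fill a \<eta> \<circ> \<pi>)(i := True)) i'"
      proof (cases "i' = i")
        case True
        thus ?thesis using fill_block[OF j(1)] i j by simp
      next
        case False
        hence "\<pi> i' \<noteq> j" using inj by simp
        thus ?thesis using other False by simp
      qed
    qed
    have "\<not> fill a \<eta> j" using fill_block[OF j(1)] j(2) by simp
    thus "fill a \<eta> \<circ> \<pi> = (fill a \<eta> \<circ> \<pi>)(i := False)" using i by (auto simp: fun_eq_iff)
  qed
qed

text \<open>The second summand accounts for leaving the box \<open>W\<close>, the first for the event that some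
  point of the box is sent into the exceptional set \<open>B\<close>: a fixed \<open>a\<close> in the box has weight at least
  \<open>\<theta> ^ CARD('k)\<close>, so conditioning on it costs at most this factor.\<close>

lemma prob_le_sparse:
  fixes \<theta> \<beta> M :: real and n :: nat
  defines "W \<equiv> \<lambda>k. {x. \<theta> \<le> pmf (binomial_pmf (card (I k)) p) x}"
  assumes \<theta>: "\<theta> > 0"
    and size: "\<And>k. card (I k) \<le> n"
    and \<beta>: "\<And>k x. pmf (binomial_pmf (card (I k)) p) x \<le> \<beta>"
    and sparse: "\<And>\<pi> \<eta>. \<pi> \<in> block_perms \<Longrightarrow>
          \<forall>a. (\<forall>k. a k \<in> W k) \<longrightarrow> fill a \<eta> \<circ> \<pi> \<notin> B \<Longrightarrow>
          real (card {a. (\<forall>k. a k \<in> W k) \<and> fill a \<eta> \<circ> \<pi> \<in> E}) \<le> M"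
    and M: "M \<ge> 0"
  shows "measure_pmf.prob cube E \<le> (real n + 1) ^ CARD('k) * (measure_pmf.prob cube B / \<theta> ^ CARD('k))
           + real CARD('k) * ((real n + 1) * \<theta>) + M * \<beta> ^ CARD('k)"
proof -
  define \<Lambda> where "\<Lambda> = pair_pmf (pmf_of_set block_perms) cube"
  define X where "X = (\<lambda>((\<pi> :: 'a \<Rightarrow> 'a, \<eta>), a). fill a \<eta> \<circ> \<pi>)"
  define box where "box = {a. \<forall>k. a k \<in> W k}"
  define NG where "NG = {\<omega>. \<exists>a\<in>box. X (\<omega>, a) \<in> B}"
  \<comment> \<open>The main event: the whole grid avoids \<open>B\<close>, the counts lie in the
    box and the sample lands in \<open>E\<close>.\<close>
  define S where "S = {(\<omega>, a). fst \<omega> \<in> block_perms \<and> \<omega> \<notin> NG \<and> a \<in> box \<and> X (\<omega>, a) \<in> E}"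
  have \<beta>0: "\<beta> \<ge> 0" by (rule order_trans[OF pmf_nonneg \<beta>])
  have cube: "cube = map_pmf X (pair_pmf \<Lambda> counts_pmf)"
    unfolding X_def \<Lambda>_def by (rule cube_conv_random_fill)
  have Wn: "x \<le> n" if "x \<in> W k" for x k
  proof (rule ccontr)
    assume "\<not> x \<le> n"
    hence "card (I k) < x" using size[of k] by linarith
    thus False using that \<theta> p01 by (simp add: W_def binomial_eq_0)
  qed
  have box_sub: "box \<subseteq> (\<Pi>\<^sub>E k\<in>UNIV. {..n})"
    using Wn by (auto simp: box_def PiE_def)
  have fin': "finite (\<Pi>\<^sub>E k\<in>(UNIV :: 'k set). {..n})"
    by (intro finite_PiE) auto
  have fin: "finite box"
    using finite_subset[OF box_sub fin'] .
  have "card box \<le> (n + 1) ^ CARD('k)"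
    using card_mono[OF fin' box_sub] by (simp add: card_PiE)
  hence card_box: "real (card box) \<le> (real n + 1) ^ CARD('k)"
    by (metis of_nat_1 of_nat_add of_nat_mono of_nat_power)
  have pmf_counts: "pmf counts_pmf a = (\<Prod>k\<in>UNIV. pmf (binomial_pmf (card (I k)) p) (a k))" for a
    unfolding counts_pmf_def by (subst pmf_Pi') auto

  have "measure_pmf.prob \<Lambda> {\<omega>. X (\<omega>, a) \<in> B} \<le> measure_pmf.prob cube B / \<theta> ^ CARD('k)"
    if "a \<in> box" for a
  proof -
    have "\<theta> ^ CARD('k) = (\<Prod>k\<in>(UNIV :: 'k set). \<theta>)" by simp
    also have "\<dots> \<le> pmf counts_pmf a"
      unfolding pmf_counts using that \<theta> by (intro prod_mono) (auto simp: box_def W_def)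
    finally have "measure_pmf.prob \<Lambda> {\<omega>. X (\<omega>, a) \<in> B} * \<theta> ^ CARD('k)
        \<le> measure_pmf.prob \<Lambda> {\<omega>. X (\<omega>, a) \<in> B} * pmf counts_pmf a"
      by (intro mult_left_mono) auto
    \<comment> \<open>By independence this product is the probability of a rectangle, contained up
      to null sets in the event that the sample falls into \<open>B\<close>. The support is
      countable, as the product formula requires.\<close>
    also have "\<dots> = measure_pmf.prob \<Lambda> ({\<omega>. X (\<omega>, a) \<in> B} \<inter> set_pmf \<Lambda>) * measure_pmf.prob counts_pmf {a}"
      by (simp add: measure_Int_set_pmf measure_pmf_single)
    also have "\<dots> = measure_pmf.prob (pair_pmf \<Lambda> counts_pmf)
        (({\<omega>. X (\<omega>, a) \<in> B} \<inter> set_pmf \<Lambda>) \<times> {a})"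
      by (rule measure_pmf_prob_product[symmetric]) auto
    also have "\<dots> \<le> measure_pmf.prob (pair_pmf \<Lambda> counts_pmf) (X -` B)"
      by (intro measure_pmf.finite_measure_mono) auto
    also have "\<dots> = measure_pmf.prob cube B"
      by (subst cube) simp
    finally show ?thesis using \<theta> by (simp add: field_simps)
  qed
  hence "(\<Sum>a\<in>box. measure_pmf.prob \<Lambda> {\<omega>. X (\<omega>, a) \<in> B})
      \<le> real (card box) * (measure_pmf.prob cube B / \<theta> ^ CARD('k))"
    by (rule sum_bounded_above)
  also have "\<dots> \<le> (real n + 1) ^ CARD('k) * (measure_pmf.prob cube B / \<theta> ^ CARD('k))"
    using \<theta> by (intro mult_right_mono card_box) auto
  finally have sumB: "(\<Sum>a\<in>box. measure_pmf.prob \<Lambda> {\<omega>. X (\<omega>, a) \<in> B})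
      \<le> (real n + 1) ^ CARD('k) * (measure_pmf.prob cube B / \<theta> ^ CARD('k))" .
  have "measure_pmf.prob \<Lambda> NG \<le> (\<Sum>a\<in>box. measure_pmf.prob \<Lambda> {\<omega>. X (\<omega>, a) \<in> B})"
  proof -
    have "NG = (\<Union>a\<in>box. {\<omega>. X (\<omega>, a) \<in> B})" by (auto simp: NG_def)
    thus ?thesis using fin by (simp add: measure_pmf.finite_measure_subadditive_finite)
  qed
  with sumB have NG: "measure_pmf.prob \<Lambda> NG
      \<le> (real n + 1) ^ CARD('k) * (measure_pmf.prob cube B / \<theta> ^ CARD('k))"
    by linarith

  \<comment> \<open>At most \<open>n + 1\<close> values are possible for each count, and those
    outside \<open>W k\<close> have weight below \<open>\<theta>\<close>.\<close>
  have "measure_pmf.prob counts_pmf {a. a k \<notin> W k} \<le> (real n + 1) * \<theta>" for k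
  proof -
    let ?b = "binomial_pmf (card (I k)) p"
    have "measure_pmf.prob counts_pmf {a. a k \<notin> W k}
        = measure_pmf.prob (map_pmf (\<lambda>a. a k) counts_pmf) (- W k)"
      by (simp add: vimage_def)
    also have "map_pmf (\<lambda>a. a k) counts_pmf = ?b"
      unfolding counts_pmf_def by (subst Pi_pmf_component) auto
    also have "measure_pmf.prob ?b (- W k) = measure_pmf.prob ?b (- W k \<inter> {..card (I k)})"
      using measure_Int_set_pmf[of ?b "- W k"] p01 by simp
    also have "\<dots> = (\<Sum>x\<in>- W k \<inter> {..card (I k)}. pmf ?b x)"
      by (rule measure_measure_pmf_finite) auto
    also have "\<dots> \<le> real (card (- W k \<inter> {..card (I k)})) * \<theta>"
      by (intro sum_bounded_above) (auto simp: W_def)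
    also have "\<dots> \<le> (real n + 1) * \<theta>"
    proof -
      have "card (- W k \<inter> {..card (I k)}) \<le> card {..card (I k)}"
        by (intro card_mono) auto
      also have "\<dots> \<le> n + 1" using size[of k] by simp
      finally show ?thesis using \<theta> by (intro mult_right_mono) auto
    qed
    finally show ?thesis .
  qed
  hence "(\<Sum>k\<in>UNIV. measure_pmf.prob counts_pmf {a. a k \<notin> W k})
      \<le> real CARD('k) * ((real n + 1) * \<theta>)"
    by (rule sum_bounded_above)
  moreover have "measure_pmf.prob counts_pmf (- box)
      \<le> (\<Sum>k\<in>UNIV. measure_pmf.prob counts_pmf {a. a k \<notin> W k})"
  proof -
    have "- box = (\<Union>k. {a. a k \<notin> W k})" by (auto simp: box_def)
    thus ?thesis by (simp add: measure_pmf.finite_measure_subadditive_finite)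
  qed
  ultimately have tail: "measure_pmf.prob counts_pmf (- box) \<le> real CARD('k) * ((real n + 1) * \<theta>)"
    by linarith

  have S: "measure_pmf.prob (pair_pmf \<Lambda> counts_pmf) S \<le> M * \<beta> ^ CARD('k)"
  proof (rule prob_pair_pmf_le)
    fix \<omega> assume "\<omega> \<in> set_pmf \<Lambda>"
    show "measure_pmf.prob counts_pmf {a. (\<omega>, a) \<in> S} \<le> M * \<beta> ^ CARD('k)"
    proof (cases "fst \<omega> \<in> block_perms \<and> \<omega> \<notin> NG")
      case True
      obtain \<pi> \<eta> where \<omega>: "\<omega> = (\<pi>, \<eta>)" by (cases \<omega>)
      define T where "T = {a. (\<forall>k. a k \<in> W k) \<and> fill a \<eta> \<circ> \<pi> \<in> E}"
      have T: "{a. (\<omega>, a) \<in> S} = T"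
        using True by (auto simp: S_def T_def box_def \<omega> X_def)
      have "finite T" using fin by (rule rev_finite_subset) (auto simp: T_def box_def)
      hence "measure_pmf.prob counts_pmf T = (\<Sum>a\<in>T. pmf counts_pmf a)"
        by (rule measure_measure_pmf_finite)
      also have "\<dots> \<le> real (card T) * \<beta> ^ CARD('k)"
      proof (rule sum_bounded_above)
        fix a
        have "pmf counts_pmf a \<le> (\<Prod>k\<in>(UNIV :: 'k set). \<beta>)"
          unfolding pmf_counts using \<beta> by (intro prod_mono) auto
        thus "pmf counts_pmf a \<le> \<beta> ^ CARD('k)" by simp
      qed
      also have "\<dots> \<le> M * \<beta> ^ CARD('k)"
        unfolding T_def using True \<beta>0
        by (intro mult_right_mono sparse) (auto simp: \<omega> NG_def box_def X_def)
      finally show ?thesis using T by simp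
    next
      case False
      hence "{a. (\<omega>, a) \<in> S} = {}" by (auto simp: S_def)
      thus ?thesis using M \<beta>0 by simp
    qed
  qed

  have "measure_pmf.prob cube E = measure_pmf.prob (pair_pmf \<Lambda> counts_pmf) (X -` E)"
    by (subst cube) simp
  \<comment> \<open>On the support the first component is a block permutation, which
    \<open>S\<close> demands.\<close>
  also have "\<dots> = measure_pmf.prob (pair_pmf \<Lambda> counts_pmf) (X -` E \<inter> set_pmf (pair_pmf \<Lambda> counts_pmf))"
    by (rule measure_Int_set_pmf[symmetric])
  also have "\<dots> \<le> measure_pmf.prob (pair_pmf \<Lambda> counts_pmf) (fst -` NG \<union> snd -` (- box) \<union> S)"
  proof (rule measure_pmf.finite_measure_mono)
    show "X -` E \<inter> set_pmf (pair_pmf \<Lambda> counts_pmf) \<subseteq> fst -` NG \<union> snd -` (- box) \<union> S"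
      using finite_block_perms block_perms_nonempty by (auto simp: S_def \<Lambda>_def)
  qed simp
  also have "\<dots> \<le> measure_pmf.prob (pair_pmf \<Lambda> counts_pmf) (fst -` NG)
      + measure_pmf.prob (pair_pmf \<Lambda> counts_pmf) (snd -` (- box))
      + measure_pmf.prob (pair_pmf \<Lambda> counts_pmf) S"
    by (intro order_trans[OF measure_Un_le] add_right_mono measure_Un_le) auto
  also have "measure_pmf.prob (pair_pmf \<Lambda> counts_pmf) (fst -` NG) = measure_pmf.prob \<Lambda> NG"
    by (subst measure_map_pmf[symmetric]) (simp add: map_fst_pair_pmf)
  also have "measure_pmf.prob (pair_pmf \<Lambda> counts_pmf) (snd -` (- box))
      = measure_pmf.prob counts_pmf (- box)"
    by (subst measure_map_pmf[symmetric]) (simp add: map_snd_pair_pmf)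
  finally show ?thesis using NG tail S by linarith
qed

end

subsection \<open>Anticoncentration\<close>

text \<open>Evaluates the two error terms for \<open>\<theta>\<close> equal to n^-(d+1), with
  \<open>\<delta>\<close> bounding the probability of a bad derivative among at most
  \<open>d * n\<close> coordinates.\<close>

lemma error_terms_bound:
  fixes n d :: nat and \<delta> :: real
  assumes n: "n \<ge> 1" and d: "d \<ge> 1" and \<delta>: "\<delta> \<le> real d * real n * real n powr (- 6 * real d ^ 2)"
  shows "(real n + 1) ^ d * (\<delta> / ((1 / real n) ^ (d + 1)) ^ d) + real d * ((real n + 1) * (1 / real n) ^ (d + 1))
           \<le> (2 ^ d * real d + 2 * real d) * (1 / real n) ^ d"
proof -
  have n0: "real n > 0" "real n + 1 \<le> 2 * real n" using n by auto
  have "real n powr (- 6 * real d ^ 2) = real n powr (- real (6 * d ^ 2))"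
    by simp
  also have "\<dots> = (1 / real n) ^ (6 * d ^ 2)"
    unfolding powr_minus powr_realpow[OF n0(1)] by (simp add: power_one_over inverse_eq_divide)
  finally have pw: "real n powr (- 6 * real d ^ 2) = (1 / real n) ^ (6 * d ^ 2)" .
  have cancel: "real n * (1 / real n) = 1" using n0 by simp
  \<comment> \<open>Powers of n to be paid for: d for the grid points, 1 for the coordinates, d(d+1)
    for conditioning on the counts, and d for the bound that remains.\<close>
  have exp: "d + 1 + d * (d + 1) + d \<le> 6 * d ^ 2"
  proof -
    have "d \<le> d ^ 2" "1 \<le> d ^ 2" using d by (auto simp: power2_eq_square)
    moreover have "d * (d + 1) = d ^ 2 + d" by (simp add: power2_eq_square)
    ultimately show ?thesis by linarith
  qed
  have "\<delta> / ((1 / real n) ^ (d + 1)) ^ d \<le> real d * real n * (1 / real n) ^ (6 * d ^ 2) / ((1 / real n) ^ (d + 1)) ^ d"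
    using \<delta> n0 unfolding pw by (intro divide_right_mono) auto
  also have "\<dots> = real d * real n ^ (1 + d * (d + 1)) * (1 / real n) ^ (6 * d ^ 2)"
  proof -
    have "((1 / real n) ^ (d + 1)) ^ d = 1 / real n ^ (d * (d + 1))"
      by (simp only: power_mult[symmetric] mult.commute[of d] power_one_over)
    thus ?thesis by (simp only: power_Suc plus_1_eq_Suc) (simp only: mult_ac divide_divide_eq_right div_by_1)
  qed
  finally have "(real n + 1) ^ d * (\<delta> / ((1 / real n) ^ (d + 1)) ^ d)
      \<le> (2 * real n) ^ d * (real d * real n ^ (1 + d * (d + 1)) * (1 / real n) ^ (6 * d ^ 2))"
    using n0
    by (intro order_trans[OF mult_left_mono mult_right_mono] power_mono) auto
  also have "\<dots> = 2 ^ d * real d * (real n ^ (d + 1 + d * (d + 1)) * (1 / real n) ^ (6 * d ^ 2))"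
    by (simp add: power_mult_distrib power_add mult_ac)
  also have "\<dots> \<le> 2 ^ d * real d * (real n ^ (d + 1 + d * (d + 1)) * (1 / real n) ^ (d + 1 + d * (d + 1) + d))"
    using exp n by (intro mult_left_mono power_decreasing) auto
  also have "\<dots> = 2 ^ d * real d * ((real n * (1 / real n)) ^ (d + 1 + d * (d + 1)) * (1 / real n) ^ d)"
    by (simp only: power_mult_distrib power_add[of "1 / real n" "d + 1 + d * (d + 1)" d] mult.assoc)
  also have "\<dots> = 2 ^ d * real d * (1 / real n) ^ d"
    unfolding cancel by simp
  finally have 1: "(real n + 1) ^ d * (\<delta> / ((1 / real n) ^ (d + 1)) ^ d) \<le> 2 ^ d * real d * (1 / real n) ^ d" .
  have "real d * ((real n + 1) * (1 / real n) ^ (d + 1)) \<le> real d * ((2 * real n) * (1 / real n) ^ (d + 1))"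
    using n0 by (intro mult_left_mono mult_right_mono) auto
  also have "\<dots> = 2 * real d * ((real n * (1 / real n)) * (1 / real n) ^ d)"
    by simp
  also have "\<dots> = 2 * real d * (1 / real n) ^ d"
    unfolding cancel by simp
  finally show ?thesis using 1 by (simp add: distrib_right)
qed

theorem theorem3p1:
  fixes p \<epsilon> :: real and m :: nat and v :: "nat \<Rightarrow> real ^ 'd"
  assumes "0 < p" and "p < 1" and "0 < \<epsilon>" and "\<epsilon> < 1"
    and "m \<ge> CARD('d)"
    and "span (v ` {1..m}) = UNIV"
  shows "\<exists>c>0. \<forall>(n::nat) (f :: (nat \<Rightarrow> bool) \<Rightarrow> real ^ 'd) (r::real) (s::real) (I :: nat \<Rightarrow> nat set).
    n \<ge> 1 \<longrightarrow> r > 0 \<longrightarrow> s > 0 \<longrightarrow> r * sqrt (real n * ln (real n)) \<ge> s \<longrightarrow>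
    disjoint_family_on I {1..m} \<longrightarrow>
    (\<forall>j\<in>{1..m}. I j \<subseteq> {1..n} \<and> real (card (I j)) \<ge> \<epsilon> * real n) \<longrightarrow>
    (\<forall>j\<in>{1..m}. \<forall>i\<in>I j.
       measure_pmf.prob (ber_cube p n) {\<xi>. infnorm (discrete_deriv i f \<xi> - s *\<^sub>R v j) \<ge> r}
         \<le> real n powr (- 6 * real (CARD('d)) ^ 2)) \<longrightarrow>
    (\<forall>x :: real ^ 'd.
       measure_pmf.prob (ber_cube p n) {\<xi>. infnorm (f \<xi> - x) < r * sqrt (real n * ln (real n))}
         \<le> c * (r * sqrt (ln (real n)) / s) ^ CARD('d))"
proof -
  obtain \<iota> :: "'d \<Rightarrow> nat" where \<iota>: "inj \<iota>" "range \<iota> \<subseteq> {1..m}" "span (range (v \<circ> \<iota>)) = UNIV"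
    using spanning_subfamily[OF assms(6)] by blast
  define w where "w k = v (\<iota> k)" for k
  obtain \<kappa> where \<kappa>: "\<kappa> > 0"
      "\<And>(t :: 'd \<Rightarrow> real) k. \<kappa> * \<bar>t k\<bar> \<le> infnorm (\<Sum>k\<in>UNIV. t k *\<^sub>R w k)"
    using spanning_family_bounded_below[of w] \<iota>(3) by (auto simp: w_def[abs_def] o_def)
  define d where "d = CARD('d)"
  have d: "d \<ge> 1" by (simp add: d_def Suc_leI)
  define C where "C = 4 / sqrt (\<epsilon> * p * (1 - p))"
  \<comment> \<open>\<open>c0\<close> makes the bound trivial when \<open>r\<close> is not small,
    \<open>c1\<close> covers the error terms, and \<open>c2\<close> is the grid count times the
    maximal weight, where \<open>C / sqrt n\<close> bounds each binomial weight.\<close>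
  define c0 where "c0 = (2 * real d / (\<kappa> * sqrt (ln 2))) ^ d"
  define c1 where "c1 = 2 ^ d * real d + 2 * real d"
  define c2 where "c2 = ((4 / \<kappa> + 1) * C) ^ d"
  have c: "c0 \<ge> 0" "c1 > 0" "c2 \<ge> 0"
    using \<kappa>(1) assms d by (auto simp: c0_def c1_def c2_def C_def add_pos_pos)
  have main: "measure_pmf.prob (ber_cube p n) {\<xi>. infnorm (f \<xi> - x) < r * sqrt (real n * ln (real n))}
         \<le> (c0 + c1 + c2) * (r * sqrt (ln (real n)) / s) ^ CARD('d)"
    if n1: "n \<ge> 1" and r: "r > 0" and s: "s > 0" and rs: "r * sqrt (real n * ln (real n)) \<ge> s"
      and disj: "disjoint_family_on I {1..m}"
      and I: "\<And>j. j \<in> {1..m} \<Longrightarrow> I j \<subseteq> {1..n}" "\<And>j. j \<in> {1..m} \<Longrightarrow> real (card (I j)) \<ge> \<epsilon> * real n"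
      and bad: "\<And>j i. j \<in> {1..m} \<Longrightarrow> i \<in> I j \<Longrightarrow>
        measure_pmf.prob (ber_cube p n) {\<xi>. infnorm (discrete_deriv i f \<xi> - s *\<^sub>R v j) \<ge> r}
          \<le> real n powr (- 6 * real (CARD('d)) ^ 2)"
    for n :: nat and f :: "(nat \<Rightarrow> bool) \<Rightarrow> real ^ 'd" and r s :: real and I :: "nat \<Rightarrow> nat set"
      and x :: "real ^ 'd"
  proof -
    define \<rho> where "\<rho> = r * sqrt (ln (real n)) / s"
    define R where "R = r * sqrt (real n * ln (real n))"
    define E where "E = {\<xi>. infnorm (f \<xi> - x) < R}"
    \<comment> \<open>For n = 1 the logarithm vanishes and \<open>s\<close> would be at most
      0.\<close>
    have n2: "n \<ge> 2"
    proof (rule ccontr)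
      assume "\<not> n \<ge> 2"
      hence "n = 1" using n1 by simp
      thus False using rs s by simp
    qed
    have \<rho>0: "\<rho> \<ge> 0" using r s n1 by (simp add: \<rho>_def)
    have R: "R = \<rho> * sqrt (real n) * s"
      using s by (simp add: R_def \<rho>_def real_sqrt_mult)
    have "1 * s \<le> \<rho> * sqrt (real n) * s" using rs unfolding R_def[symmetric] R by simp
    \<comment> \<open>This is the hypothesis relating \<open>r\<close> and \<open>s\<close>. It
      later absorbs the \<open>+ 1\<close> in the count and dominates the error terms through 1/n <=
      1/sqrt n <= \<rho>.\<close>
    hence \<rho>n: "1 \<le> \<rho> * sqrt (real n)" using s by (simp only: mult_le_cancel_right_pos)
    have "measure_pmf.prob (ber_cube p n) E \<le> (c0 + c1 + c2) * \<rho> ^ d"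
    proof (cases "r * real d \<le> \<kappa> * s / 2")
      \<comment> \<open>Here r / s exceeds \<kappa> / (2 d) and ln n >= ln 2, so the right side is
        at least 1.\<close>
      case False
      have "sqrt (ln 2) \<le> sqrt (ln (real n))" using n2 by simp
      moreover have "\<kappa> / (2 * real d) \<le> r / s"
        using False s d by (simp add: field_simps)
      ultimately have "\<kappa> / (2 * real d) * sqrt (ln 2) \<le> r / s * sqrt (ln (real n))"
        using r s by (intro mult_mono) auto
      hence "\<kappa> / (2 * real d) * sqrt (ln 2) \<le> \<rho>" by (simp add: \<rho>_def)
      hence "1 \<le> 2 * real d / (\<kappa> * sqrt (ln 2)) * \<rho>"
        using \<kappa>(1) d by (simp add: field_simps)
      hence "1 \<le> (2 * real d / (\<kappa> * sqrt (ln 2)) * \<rho>) ^ d"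
        by (rule one_le_power)
      hence "1 \<le> c0 * \<rho> ^ d" by (simp only: c0_def power_mult_distrib)
      also have "\<dots> \<le> (c0 + c1 + c2) * \<rho> ^ d"
        using c \<rho>0 by (intro mult_right_mono) auto
      finally show ?thesis
        using measure_pmf.prob_le_1[of "ber_cube p n" E] by linarith
    next
      case True
      define J where "J k = I (\<iota> k)" for k
      have \<iota>m: "\<iota> k \<in> {1..m}" for k using \<iota>(2) by blast
      have J: "J k \<subseteq> {1..n}" "real (card (J k)) \<ge> \<epsilon> * real n" for k
        using I[OF \<iota>m[of k]] by (auto simp: J_def)
      have cJ: "card (J k) \<le> n" for k
        using card_mono[OF _ J(1)[of k]] by simp
      have cJ0: "card (J k) > 0" for k
      proof -
        have "0 < \<epsilon> * real n" using assms n1 by simp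
        thus ?thesis using J(2)[of k] by linarith
      qed
      have disjJ: "J k \<inter> J l = {}" if "k \<noteq> l" for k l
        using disj \<iota>m[of k] \<iota>m[of l] inj_eq[OF \<iota>(1), of k l] that
        unfolding J_def disjoint_family_on_def by blast
      have "\<exists>g. bij_betw g (J k) {..<card (J k)}" for k
        using ex_bij_betw_finite_nat[of "J k"] finite_subset[OF J(1)]
        by (simp add: atLeast0LessThan)
      then obtain g where g: "\<And>k. bij_betw (g k) (J k) {..<card (J k)}" by metis
      define rank where "rank i = g (THE k. i \<in> J k) i" for i
      have rank: "rank i = g k i" if "i \<in> J k" for i k
      proof -
        have "(THE k. i \<in> J k) = k" using that disjJ by blast
        thus ?thesis by (simp add: rank_def)
      qed
      define U where "U = {1..n}"
      interpret block_family J U rank p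
      proof
        show "bij_betw rank (J k) {..<card (J k)}" for k
          using g[of k] rank by (subst bij_betw_cong[of _ rank "g k"]) auto
        show "disjoint_family J" using disjJ by (auto simp: disjoint_family_on_def)
      qed (use J(1) assms in \<open>auto simp: U_def\<close>)
      have cube: "cube = ber_cube p n"
        unfolding cube_def ber_cube_def by (simp only: U_def)
      define B where "B = (\<Union>(k, i)\<in>Sigma UNIV J. {\<xi>. infnorm (discrete_deriv i f \<xi> - s *\<^sub>R w k) \<ge> r})"
      define \<theta> where "\<theta> = (1 / real n) ^ (d + 1)"
      define M where "M = (4 * R / (\<kappa> * s) + 1) ^ d"
      define \<beta> where "\<beta> = C / sqrt (real n)"
      have fin: "finite (Sigma UNIV J)" by (intro finite_SigmaI) auto
      have "measure_pmf.prob cube B \<le> (\<Sum>(k, i)\<in>Sigma UNIV J.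
          measure_pmf.prob cube {\<xi>. infnorm (discrete_deriv i f \<xi> - s *\<^sub>R w k) \<ge> r})"
        unfolding B_def case_prod_unfold
        by (rule measure_pmf.finite_measure_subadditive_finite[OF fin]) auto
      also have "\<dots> \<le> real (card (Sigma UNIV J)) * real n powr (- 6 * real d ^ 2)"
        using bad[OF \<iota>m]
        by (intro sum_bounded_above) (auto simp: w_def J_def cube d_def)
      also have "\<dots> \<le> real d * real n * real n powr (- 6 * real d ^ 2)"
      proof (intro mult_right_mono)
        have "card (Sigma UNIV J) = (\<Sum>k\<in>UNIV. card (J k))" by simp
        also have "\<dots> \<le> d * n"
          unfolding d_def using cJ sum_bounded_above[of UNIV "\<lambda>k. card (J k)" n] by simp
        finally show "real (card (Sigma UNIV J)) \<le> real d * real n"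
          by (metis of_nat_mono of_nat_mult)
      qed simp
      finally have probB: "measure_pmf.prob cube B \<le> real d * real n * real n powr (- 6 * real d ^ 2)" .
      have \<beta>: "pmf (binomial_pmf (card (J k)) p) y \<le> \<beta>" for k y
      proof -
        have "pmf (binomial_pmf (card (J k)) p) y \<le> 4 / sqrt (real (card (J k)) * p * (1 - p))"
          using assms cJ0 by (intro pmf_binomial_le_inverse_sqrt) auto
        also have "\<dots> \<le> 4 / sqrt ((\<epsilon> * real n) * p * (1 - p))"
          using assms n1 J(2) by (intro divide_left_mono real_sqrt_le_mono mult_right_mono mult_pos_pos) (auto simp: cJ0)
        also have "\<dots> = \<beta>"
          by (simp add: \<beta>_def C_def real_sqrt_mult mult_ac)
        finally show ?thesis .
      qed
      have \<theta>: "\<theta> > 0" using n1 by (simp add: \<theta>_def)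
      have R0: "R \<ge> 0" using R \<rho>0 s by simp
      have M: "M \<ge> 0" unfolding M_def using R0 \<kappa>(1) s by (intro zero_le_power add_nonneg_nonneg) auto
      define W where "W k = {y. \<theta> \<le> pmf (binomial_pmf (card (J k)) p) y}" for k
      have sparse: "real (card {a. (\<forall>k. a k \<in> W k) \<and> fill a \<eta> \<circ> \<pi> \<in> E}) \<le> M"
        if \<pi>: "\<pi> \<in> block_perms" and good: "\<forall>a. (\<forall>k. a k \<in> W k) \<longrightarrow> fill a \<eta> \<circ> \<pi> \<notin> B" for \<pi> \<eta>
      proof -
        have "real (card {a. (\<forall>k. a k \<in> W k) \<and> infnorm (f (fill a \<eta> \<circ> \<pi>) - x) < R})
            \<le> (4 * R / (\<kappa> * s) + 1) ^ CARD('d)"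
        proof (rule card_quasi_isometric_grid_le[where w = w and r = r])
          show "y \<in> W k" if "x \<in> W k" "z \<in> W k" "x \<le> y" "y \<le> z" for k x y z
            using that binomial_pmf_interval[OF assms(1,2), of x y z \<theta> "card (J k)"]
            by (simp add: W_def)
          show "infnorm (f (fill (a(k := Suc (a k))) \<eta> \<circ> \<pi>) - f (fill a \<eta> \<circ> \<pi>) - s *\<^sub>R w k) \<le> r"
            if a: "\<And>l. a l \<in> W l" and Suc: "Suc (a k) \<in> W k" for a k
          proof -
            \<comment> \<open>A count of positive weight is at most the block size, so the block
              still has an element to switch on.\<close>
            have "a k < card (J k)"
            proof (rule ccontr)
              assume "\<not> a k < card (J k)"
              hence "pmf (binomial_pmf (card (J k)) p) (Suc (a k)) = 0"
                using assms by (simp add: binomial_eq_0)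
              thus False using Suc \<theta> by (simp add: W_def)
            qed
            then obtain i where i: "i \<in> J k"
              "fill (a(k := Suc (a k))) \<eta> \<circ> \<pi> = (fill a \<eta> \<circ> \<pi>)(i := True)"
              "fill a \<eta> \<circ> \<pi> = (fill a \<eta> \<circ> \<pi>)(i := False)"
              using fill_Suc_conv_fun_upd[OF \<pi>] by metis
            have "discrete_deriv i f (fill a \<eta> \<circ> \<pi>)
                = f (fill (a(k := Suc (a k))) \<eta> \<circ> \<pi>) - f (fill a \<eta> \<circ> \<pi>)"
              unfolding discrete_deriv_def i(2) i(3)[symmetric] ..
            moreover have "fill a \<eta> \<circ> \<pi> \<notin> B" using a good by blast
            ultimately show ?thesis using i(1) by (fastforce simp: B_def)
          qed
        qed (use \<kappa> s r R0 True in \<open>auto simp: d_def\<close>)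
        thus ?thesis by (simp add: E_def M_def d_def)
      qed
      have "measure_pmf.prob cube E \<le> (real n + 1) ^ CARD('d) * (measure_pmf.prob cube B / \<theta> ^ CARD('d))
           + real CARD('d) * ((real n + 1) * \<theta>) + M * \<beta> ^ CARD('d)"
        using \<theta> cJ \<beta> sparse M unfolding W_def by (rule prob_le_sparse)
      also have "(real n + 1) ^ CARD('d) * (measure_pmf.prob cube B / \<theta> ^ CARD('d))
           + real CARD('d) * ((real n + 1) * \<theta>) \<le> c1 * (1 / real n) ^ d"
        unfolding \<theta>_def c1_def d_def[symmetric] using n1 d probB by (rule error_terms_bound)
      also have "c1 * (1 / real n) ^ d \<le> c1 * \<rho> ^ d"
      proof (intro mult_left_mono power_mono)
        have "1 / real n \<le> 1 / sqrt (real n)"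
          using n1 by (intro divide_left_mono) (auto intro: real_le_lsqrt simp: power2_eq_square)
        also have "\<dots> \<le> \<rho>" using \<rho>n n1 by (simp add: field_simps)
        finally show "1 / real n \<le> \<rho>" .
      qed (use c in auto)
      also have "M * \<beta> ^ CARD('d) \<le> c2 * \<rho> ^ d"
      proof -
        have C0: "C \<ge> 0" using assms by (simp add: C_def)
        \<comment> \<open>The factor \<open>sqrt n\<close> gained here cancels against the one in
          \<open>\<beta>\<close>, leaving a multiple of \<rho> for each dimension.\<close>
        have "4 * R / (\<kappa> * s) + 1 \<le> (4 / \<kappa> + 1) * (\<rho> * sqrt (real n))"
          using \<rho>n s \<kappa>(1) by (simp add: R field_simps)
        hence "(4 * R / (\<kappa> * s) + 1) * \<beta> \<le> (4 / \<kappa> + 1) * (\<rho> * sqrt (real n)) * \<beta>"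
          using C0 by (intro mult_right_mono) (auto simp: \<beta>_def)
        also have "\<dots> = (4 / \<kappa> + 1) * C * \<rho>"
          using n1 by (simp add: \<beta>_def)
        finally have "((4 * R / (\<kappa> * s) + 1) * \<beta>) ^ d \<le> ((4 / \<kappa> + 1) * C * \<rho>) ^ d"
          using R0 \<kappa>(1) s C0 by (intro power_mono mult_nonneg_nonneg add_nonneg_nonneg) (auto simp: \<beta>_def)
        thus ?thesis by (simp add: M_def c2_def power_mult_distrib d_def)
      qed
      finally have "measure_pmf.prob cube E \<le> c1 * \<rho> ^ d + c2 * \<rho> ^ d" by simp
      also have "\<dots> \<le> (c0 + c1 + c2) * \<rho> ^ d"
        using c \<rho>0 by (simp add: algebra_simps)
      finally show ?thesis by (simp add: cube)
    qed
    thus ?thesis by (simp add: E_def R_def \<rho>_def d_def)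
  qed
  show ?thesis
  proof (intro exI[of _ "c0 + c1 + c2"] conjI allI impI)
    show "0 < c0 + c1 + c2" using c by linarith
  qed (rule main, auto)
qed

end
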